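(* We have $$C_{1324,3421}(x)=\left(1+\sum_{k\ge 1}\frac{x^k}{1-x^k}\cdot\prod_{i\ge k+1}\left(1+x^i\right)\right)^2.$$
   Context: $\mathrm{av}_n^k(B)$ is the number of permutations in $S_n$ with exactly $k$ inversions (pairs $i<j$ with $\pi_i>\pi_j$) that avoid every pattern in $B$; a permutation avoids a pattern $q$ if it has no subsequence order-isomorphic to $q$. If for every $k\ge0$ there are constants $m_k,c_k(B)$ with $\mathrm{av}_n^k(B)=c_k(B)$ for all $n\ge m_k$, then $(c_k(B))_{k\ge0}$ is the limit sequence of $B$ and $C_B(x)=\sum_{k\ge 0}c_k(B)x^k$ is its limit generating function (a formal power series); here $B=\{1324,3421\}$. *)

theory Defs
  imports
    "HOL-Analysis.Infinite_Products"
    "HOL-Combinatorics.Multiset_Permutations"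
    "HOL-Computational_Algebra.Formal_Power_Series"
    "HOL-Library.Sublist"
begin

text \<open>
  Permutations and patterns are lists in one-line notation: the elements of the symmetric
  group on \<open>{1..n}\<close> are \<open>permutations_of_set {1..n}\<close>, and the pattern 1324 is \<open>[1, 3, 2, 4]\<close>.
\<close>

definition inversions :: "nat list \<Rightarrow> (nat \<times> nat) set" where
  "inversions p = {(i, j). i < j \<and> j < length p \<and> p ! i > p ! j}"

definition order_isomorphic :: "nat list \<Rightarrow> nat list \<Rightarrow> bool" where
  "order_isomorphic s q \<longleftrightarrow>
     length s = length q \<and>
     (\<forall>i<length q. \<forall>j<length q. s ! i < s ! j \<longleftrightarrow> q ! i < q ! j)"

text \<open>\<open>subseq\<close> is the not necessarily contiguous subsequence relation.\<close>

definition avoids :: "nat list \<Rightarrow> nat list \<Rightarrow> bool" where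
  "avoids p q \<longleftrightarrow> \<not> (\<exists>s. subseq s p \<and> order_isomorphic s q)"

definition av :: "nat \<Rightarrow> nat \<Rightarrow> nat list set \<Rightarrow> nat" where
  "av n k B =
     card {p \<in> permutations_of_set {1..n}. card (inversions p) = k \<and> (\<forall>q\<in>B. avoids p q)}"

definition is_limit_sequence :: "nat list set \<Rightarrow> (nat \<Rightarrow> nat) \<Rightarrow> bool" where
  "is_limit_sequence B c \<longleftrightarrow> (\<forall>k. \<exists>m. \<forall>n\<ge>m. av n k B = c k)"

text \<open>
  A limit sequence is unique if it exists; otherwise the following two constants carry no
  information, so existence has to be stated separately.
\<close>

definition limit_sequence :: "nat list set \<Rightarrow> nat \<Rightarrow> nat" where
  "limit_sequence B = (THE c. is_limit_sequence B c)"

definition limit_gf :: "nat list set \<Rightarrow> rat fps" where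
  "limit_gf B = Abs_fps (\<lambda>k. of_nat (limit_sequence B k))"

end

theory Submission
  imports Defs
begin

text \<open>
  If \<open>p\<close> avoids 1324 and has fewer than \<open>h\<close> and fewer than \<open>n - h\<close> inversions, then no inversion
  crosses the cut after position \<open>h\<close>: an inversion across the cut that could not be extended to
  1324 would force too many further inversions. Hence \<open>p = s \<oplus> t\<close> where \<open>s\<close> avoids 132 and \<open>t\<close>
  avoids 213, and both avoid 3421 since 3421 is sum-indecomposable. The inverse of the
  reverse-complement preserves inversions, fixes 3421 and exchanges 132 and 213, so the limit
  generating function is the square of the one for \<open>{132, 3421}\<close>.

  The Lehmer code turns a 132-avoider into a weakly decreasing sequence, i.e. a partition of the
  number of inversions, and avoiding 3421 means that only the smallest part may be repeated. If
  \<open>G N\<close> counts such partitions with all parts at most \<open>N\<close>, then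
  \<open>G (N + 1) = G N * (1 + x ^ (N + 1)) + x ^ (2 * (N + 1)) / (1 - x ^ (N + 1))\<close>, a recursion that
  the truncations of the claimed series satisfy as well.
\<close>

text \<open>
  Otherwise the simplifier turns the entry \<open>1\<close> of a pattern into \<open>Suc 0\<close>, and facts about the
  pattern no longer match.
\<close>

declare One_nat_def [simp del]

section \<open>Pattern occurrences\<close>

text \<open>Filtering \<open>[0..<length p]\<close> by membership in \<open>js\<close> gives back
  \<open>js\<close>, both being strictly sorted with the same elements; mapping \<open>(!) p\<close>
  carries this sublist relation over to \<open>p\<close>.\<close>

lemma subseq_map_nth:
  assumes "sorted_wrt (<) js" "\<forall>j\<in>set js. j < length p"
  shows "subseq (map ((!) p) js) p"
proof -
  have "filter (\<lambda>j. j \<in> set js) [0..<length p] = js"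
    using assms by (intro sorted_distinct_set_unique)
      (auto simp: strict_sorted_iff intro: sorted_wrt_filter)
  then have "subseq js [0..<length p]"
    by (metis subseq_filter_left)
  then have "subseq (map ((!) p) js) (map ((!) p) [0..<length p])"
    by (rule subseq_map)
  then show ?thesis by (simp add: map_nth)
qed

text \<open>Links two views of a pattern occurrence: as a sublist, which suits the induction along
  the Lehmer code, and as increasing positions, which suits the symmetry and the direct
  sums.\<close>

lemma subseq_conv_map_nth:
  "subseq s p \<longleftrightarrow>
     (\<exists>js. sorted_wrt (<) js \<and> (\<forall>j\<in>set js. j < length p) \<and> s = map ((!) p) js)"
  (is "_ \<longleftrightarrow> ?R s p")
proof
  show "subseq s p \<Longrightarrow> ?R s p"
  proof (induction p arbitrary: s)
    case Nil
    then show ?case by (intro exI[of _ "[]"]) simp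
  next
    case (Cons x p)
    show ?case
    proof (cases "subseq s p")
      case True
      then obtain js where "sorted_wrt (<) js" "\<forall>j\<in>set js. j < length p" "s = map ((!) p) js"
        using Cons.IH by blast
      then show ?thesis
        by (intro exI[of _ "map Suc js"]) (auto simp: sorted_wrt_map)
    next
      case False
      with Cons.prems obtain s' where s: "s = x # s'" "subseq s' p"
        by (metis list.exhaust list_emb_Nil subseq_Cons2_iff)
      then obtain js where "sorted_wrt (<) js" "\<forall>j\<in>set js. j < length p" "s' = map ((!) p) js"
        using Cons.IH by blast
      then show ?thesis using s
        by (intro exI[of _ "0 # map Suc js"]) (auto simp: sorted_wrt_map)
    qed
  qed
qed (auto intro: subseq_map_nth)

lemma ex_subseq3_iff:
  "(\<exists>a b c. subseq [a, b, c] p \<and> Q a b c) \<longleftrightarrow>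
     (\<exists>i j k. i < j \<and> j < k \<and> k < length p \<and> Q (p ! i) (p ! j) (p ! k))" (is "?L \<longleftrightarrow> ?R")
proof
  assume ?L
  then show ?R
    by (fastforce simp: subseq_conv_map_nth Cons_eq_map_conv)
next
  assume ?R
  then obtain i j k where *: "i < j" "j < k" "k < length p" "Q (p ! i) (p ! j) (p ! k)" by blast
  then have "subseq (map ((!) p) [i, j, k]) p" by (intro subseq_map_nth) auto
  with * show ?L by auto
qed

lemma ex_subseq4_iff:
  "(\<exists>a b c d. subseq [a, b, c, d] p \<and> Q a b c d) \<longleftrightarrow>
     (\<exists>i j k l. i < j \<and> j < k \<and> k < l \<and> l < length p \<and> Q (p ! i) (p ! j) (p ! k) (p ! l))"
  (is "?L \<longleftrightarrow> ?R")
proof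
  assume ?L
  then show ?R
    by (fastforce simp: subseq_conv_map_nth Cons_eq_map_conv)
next
  assume ?R
  then obtain i j k l where *: "i < j" "j < k" "k < l" "l < length p"
    "Q (p ! i) (p ! j) (p ! k) (p ! l)" by blast
  then have "subseq (map ((!) p) [i, j, k, l]) p" by (intro subseq_map_nth) auto
  with * show ?L by auto
qed

lemma ex_length3: "(\<exists>s. length s = 3 \<and> P s) \<longleftrightarrow> (\<exists>a b c. P [a, b, c])"
  by (simp add: numeral_eq_Suc length_Suc_conv) blast

lemma ex_length4: "(\<exists>s. length s = 4 \<and> P s) \<longleftrightarrow> (\<exists>a b c d. P [a, b, c, d])"
  by (simp add: numeral_eq_Suc length_Suc_conv) blast

lemma order_isomorphic_132: "order_isomorphic [a, b, c] [1, 3, 2] \<longleftrightarrow> a < c \<and> c < b"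
  by (auto simp: order_isomorphic_def All_less_Suc numeral_eq_Suc)

lemma order_isomorphic_213: "order_isomorphic [a, b, c] [2, 1, 3] \<longleftrightarrow> b < a \<and> a < c"
  by (auto simp: order_isomorphic_def All_less_Suc numeral_eq_Suc)

lemma order_isomorphic_1324:
  "order_isomorphic [a, b, c, d] [1, 3, 2, 4] \<longleftrightarrow> a < c \<and> c < b \<and> b < d"
  by (auto simp: order_isomorphic_def All_less_Suc numeral_eq_Suc)

lemma order_isomorphic_3421:
  "order_isomorphic [a, b, c, d] [3, 4, 2, 1] \<longleftrightarrow> d < c \<and> c < a \<and> a < b"
  by (auto simp: order_isomorphic_def All_less_Suc numeral_eq_Suc)

lemma avoids3: "avoids p [x, y, z] \<longleftrightarrow>
    \<not> (\<exists>a b c. subseq [a, b, c] p \<and> order_isomorphic [a, b, c] [x, y, z])"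
proof -
  have "avoids p [x, y, z] \<longleftrightarrow>
      \<not> (\<exists>s. length s = 3 \<and> subseq s p \<and> order_isomorphic s [x, y, z])"
    by (auto simp: avoids_def order_isomorphic_def)
  then show ?thesis by (simp only: ex_length3)
qed

lemma avoids4: "avoids p [x, y, z, w] \<longleftrightarrow>
    \<not> (\<exists>a b c d. subseq [a, b, c, d] p \<and> order_isomorphic [a, b, c, d] [x, y, z, w])"
proof -
  have "avoids p [x, y, z, w] \<longleftrightarrow>
      \<not> (\<exists>s. length s = 4 \<and> subseq s p \<and> order_isomorphic s [x, y, z, w])"
    by (auto simp: avoids_def order_isomorphic_def)
  then show ?thesis by (simp only: ex_length4)
qed

lemmas avoids_132 = avoids3[of _ 1 3 2, unfolded order_isomorphic_132]
  and avoids_213 = avoids3[of _ 2 1 3, unfolded order_isomorphic_213]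
  and avoids_1324 = avoids4[of _ 1 3 2 4, unfolded order_isomorphic_1324]
  and avoids_3421 = avoids4[of _ 3 4 2 1, unfolded order_isomorphic_3421]

lemmas avoids_132_nth = avoids_132[unfolded ex_subseq3_iff]
  and avoids_213_nth = avoids_213[unfolded ex_subseq3_iff]
  and avoids_1324_nth = avoids_1324[unfolded ex_subseq4_iff]
  and avoids_3421_nth = avoids_3421[unfolded ex_subseq4_iff]

section \<open>Lehmer codes\<close>

primrec lehmer_code :: "nat list \<Rightarrow> nat list" where
  "lehmer_code [] = []"
| "lehmer_code (x # xs) = card {y \<in> set xs. y < x} # lehmer_code xs"

lemma length_lehmer_code [simp]: "length (lehmer_code p) = length p"
  by (induction p) auto

text \<open>The entries of \<open>q\<close> are too large to be counted by any entry of
  \<open>p\<close>. For direct sums this makes the codes concatenate.\<close>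

lemma lehmer_code_append:
  assumes "\<And>x y. x \<in> set p \<Longrightarrow> y \<in> set q \<Longrightarrow> x < y"
  shows "lehmer_code (p @ q) = lehmer_code p @ lehmer_code q"
  using assms
proof (induction p)
  case (Cons x p)
  have "{y \<in> set (p @ q). y < x} = {y \<in> set p. y < x}"
    using Cons.prems by fastforce
  then show ?case using Cons by simp
qed simp

lemma lehmer_code_map:
  assumes "strict_mono f"
  shows "lehmer_code (map f p) = lehmer_code p"
proof (induction p)
  case (Cons x p)
  have "{y \<in> f ` set p. y < f x} = f ` {y \<in> set p. y < x}"
    using assms by (auto simp: strict_mono_less)
  then have "card {y \<in> f ` set p. y < f x} = card {y \<in> set p. y < x}"
    using assms by (simp add: card_image strict_mono_eq inj_on_def)
  then show ?case using Cons by simp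
qed simp

lemma finite_inversions [simp]: "finite (inversions p)"
  by (rule finite_subset[of _ "{..<length p} \<times> {..<length p}"]) (auto simp: inversions_def)

lemma inversions_Cons:
  "inversions (x # p) = (\<lambda>j. (0, Suc j)) ` {j. j < length p \<and> p ! j < x} \<union> map_prod Suc Suc ` inversions p"
  (is "_ = ?A \<union> ?B")
proof -
  have "(i, j) \<in> inversions (x # p) \<longleftrightarrow> (i, j) \<in> ?A \<union> ?B" for i j
    by (cases i; cases j) (auto simp: inversions_def)
  then show ?thesis by auto
qed

text \<open>Each code entry counts the inversions whose left end is at that position; distinctness
  lets right ends be counted by their values.\<close>

lemma card_inversions:
  assumes "distinct p"
  shows "card (inversions p) = sum_list (lehmer_code p)"
  using assms
proof (induction p)
  case Nil
  then show ?case by (simp add: inversions_def)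
next
  case (Cons x p)
  let ?J = "{j. j < length p \<and> p ! j < x}"
  have "(!) p ` ?J = {y \<in> set p. y < x}"
    by (auto simp: in_set_conv_nth)
  moreover have "inj_on ((!) p) ?J"
    using Cons.prems by (auto simp: inj_on_def nth_eq_iff_index_eq)
  ultimately have "card ?J = card {y \<in> set p. y < x}"
    using card_image by fastforce
  moreover have image_card: "card ((\<lambda>j. (0 :: nat, Suc j)) ` ?J) = card ?J"
    "card (map_prod Suc Suc ` inversions p) = card (inversions p)"
    by (rule card_image; auto simp: inj_on_def)+
  have "card (inversions (x # p)) = card ?J + card (inversions p)"
    unfolding inversions_Cons
    by (subst card_Un_disjoint) (auto simp: image_card)
  ultimately show ?case using Cons by simp
qed

section \<open>Which sequences are Lehmer codes of permutations\<close>

primrec valid_code :: "nat list \<Rightarrow> bool" where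
  "valid_code [] = True"
| "valid_code (a # c) \<longleftrightarrow> a \<le> length c \<and> valid_code c"

lemma permutations_of_set_Cons_iff:
  "x # xs \<in> permutations_of_set A \<longleftrightarrow> x \<in> A \<and> xs \<in> permutations_of_set (A - {x})"
  by (auto simp: permutations_of_set_def)

lemma rank_inj:
  fixes x y :: nat
  assumes "finite A" "x \<in> A" "y \<in> A" "card {z \<in> A. z < x} = card {z \<in> A. z < y}"
  shows "x = y"
proof -
  have "card {z \<in> A. z < x} < card {z \<in> A. z < y}" if "x < y" "x \<in> A" for x y
    using that assms(1) by (intro psubset_card_mono) (auto intro: order.strict_trans)
  from this[of x y] this[of y x] show ?thesis
    using assms by (cases x y rule: linorder_cases) auto
qed

text \<open>Ranks in \<open>A\<close> are pairwise different by \<open>rank_inj\<close> and lie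
  below \<open>card A\<close>, so by counting they take every value below
  \<open>card A\<close>.\<close>

lemma ex_rank:
  fixes A :: "nat set"
  assumes "finite A" "a < card A"
  shows "\<exists>x\<in>A. card {y \<in> A. y < x} = a"
proof -
  let ?r = "\<lambda>x. card {y \<in> A. y < x}"
  have "?r x < card A" if "x \<in> A" for x
    using assms(1) that by (intro psubset_card_mono) auto
  then have "?r ` A \<subseteq> {..<card A}" by auto
  moreover have "card (?r ` A) = card A"
    using rank_inj[OF assms(1)] by (intro card_image) (auto simp: inj_on_def)
  ultimately have "?r ` A = {..<card A}" by (intro card_subset_eq) auto
  then show ?thesis using assms(2) by (metis (no_types, lifting) imageE lessThan_iff)
qed

lemma rank_remove:
  fixes x :: nat
  shows "{y \<in> A - {x}. y < x} = {y \<in> A. y < x}"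
  by auto

text \<open>The first code entry is the rank of the first letter in \<open>A\<close> and so
  determines it. The remaining word permutes \<open>A - {x}\<close>, which is why both inductions
  range over arbitrary sets.\<close>

lemma bij_betw_lehmer_code:
  assumes "finite A"
  shows "bij_betw lehmer_code (permutations_of_set A) {c. length c = card A \<and> valid_code c}"
proof -
  have inj: "p = q" if "finite A" "p \<in> permutations_of_set A" "q \<in> permutations_of_set A"
    "lehmer_code p = lehmer_code q" for p q and A :: "nat set"
    using that
  proof (induction p arbitrary: A q)
    case Nil
    then show ?case by (cases q) auto
  next
    case (Cons x p)
    obtain y q' where q: "q = y # q'"
      using Cons.prems(4) by (cases q) auto
    have "x = y"
    proof (rule rank_inj)
      show "finite A" "x \<in> A" "y \<in> A"
        using Cons.prems by (auto simp: q permutations_of_set_Cons_iff)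
      have "set p = A - {x}" "set q' = A - {y}"
        using Cons.prems by (auto simp: q permutations_of_set_def)
      moreover have "card {z \<in> set p. z < x} = card {z \<in> set q'. z < y}"
        using Cons.prems(4) by (simp add: q)
      ultimately show "card {z \<in> A. z < x} = card {z \<in> A. z < y}"
        by (simp only: rank_remove)
    qed
    then show ?case
      using Cons.prems Cons.IH[of "A - {x}" q'] unfolding q permutations_of_set_Cons_iff by auto
  qed
  have valid: "valid_code (lehmer_code p)" for p
  proof (induction p)
    case (Cons x p)
    have "card {y \<in> set p. y < x} \<le> card (set p)" by (intro card_mono) auto
    also have "\<dots> \<le> length p" by (rule card_length)
    finally show ?case using Cons by simp
  qed simp
  have surj: "\<exists>p \<in> permutations_of_set A. lehmer_code p = c"
    if "finite A" "length c = card A" "valid_code c" for c and A :: "nat set"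
    using that
  proof (induction c arbitrary: A)
    case Nil
    then show ?case by auto
  next
    case (Cons a c)
    then obtain x where x: "x \<in> A" "card {y \<in> A. y < x} = a"
      using ex_rank[of A a] by auto
    moreover from this Cons.prems have "length c = card (A - {x})" by simp
    ultimately obtain p where p: "p \<in> permutations_of_set (A - {x})" "lehmer_code p = c"
      using Cons.IH[of "A - {x}"] Cons.prems by auto
    then have "card {y \<in> set p. y < x} = a"
      using x by (simp only: permutations_of_setD rank_remove)
    then show ?case using x p
      by (intro bexI[of _ "x # p"])
        (simp_all add: permutations_of_set_Cons_iff)
  qed
  show ?thesis
    unfolding bij_betw_def
  proof
    show "inj_on lehmer_code (permutations_of_set A)"
      using inj[OF assms] by (auto simp: inj_on_def)
    show "lehmer_code ` permutations_of_set A = {c. length c = card A \<and> valid_code c}"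
      using surj[OF assms] valid assms
      by (auto simp: length_finite_permutations_of_set)
  qed
qed

section \<open>Good codes and avoidance of 132 and 3421\<close>

text \<open>Codes are padded with zeros, so a repeated part may be followed by \<open>0\<close> as well.\<close>

primrec good_code :: "nat list \<Rightarrow> bool" where
  "good_code [] = True"
| "good_code (a # c) \<longleftrightarrow> good_code c \<and> ((\<forall>b\<in>set c. b < a) \<or> set c \<subseteq> {a, 0})"

lemma good_code_imp_le_hd:
  assumes "good_code (a # c)" "b \<in> set c"
  shows "b \<le> a"
  using assms by (auto intro: less_imp_le)

text \<open>A positive head lowers the sum by at least one and the length by exactly one, so the
  bound passes to the tail; a zero head leaves only zeros. The disjunct \<open>c = []\<close> serves
  the end of the induction.\<close>

lemma good_code_imp_valid:
  assumes "good_code c" "sum_list c < length c \<or> c = []"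
  shows "valid_code c"
  using assms
proof (induction c)
  case (Cons a c)
  show ?case
  proof (cases "a = 0")
    case True
    with Cons.prems have "set c \<subseteq> {0}" by auto
    then have "sum_list c = 0" by auto
    then have "sum_list c < length c \<or> c = []" by (simp only: length_greater_0_conv) blast
    then show ?thesis using Cons True by auto
  next
    case False
    then show ?thesis using Cons by auto
  qed
qed simp

lemma in_set_lehmer_code:
  "a \<in> set (lehmer_code p) \<longleftrightarrow> (\<exists>us v vs. p = us @ v # vs \<and> a = card {w \<in> set vs. w < v})"
proof (induction p)
  case (Cons x p)
  have "(\<exists>us v vs. x # p = us @ v # vs \<and> a = card {w \<in> set vs. w < v}) \<longleftrightarrow>
     a = card {w \<in> set p. w < x} \<or> (\<exists>us v vs. p = us @ v # vs \<and> a = card {w \<in> set vs. w < v})"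
    by (simp add: Cons_eq_append_conv) blast
  then show ?case using Cons by auto
qed simp

lemma subseq2_iff:
  "subseq [a, b] p \<longleftrightarrow> (\<exists>us vs. p = us @ a # vs \<and> b \<in> set vs)"
  by (induction p) (auto simp: Cons_eq_append_conv subseq_singleton_left)

lemma subseq_Cons_iff:
  "subseq (a # s) (x # p) \<longleftrightarrow> a = x \<and> subseq s p \<or> subseq (a # s) p"
  by (auto intro: subseq_Cons')

lemma avoids_132_Cons:
  "avoids (x # p) [1, 3, 2] \<longleftrightarrow>
     avoids p [1, 3, 2] \<and> \<not> (\<exists>b c. subseq [b, c] p \<and> x < c \<and> c < b)"
  unfolding avoids_132 subseq_Cons_iff by blast

lemma avoids_3421_Cons:
  "avoids (x # p) [3, 4, 2, 1] \<longleftrightarrow>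
     avoids p [3, 4, 2, 1] \<and> \<not> (\<exists>b c d. subseq [b, c, d] p \<and> d < c \<and> c < x \<and> x < b)"
  unfolding avoids_3421 subseq_Cons_iff by blast

lemma subseq_set: "subseq s p \<Longrightarrow> set s \<subseteq> set p"
  by (auto elim: list_emb_set)

lemma subseq3_append:
  assumes "x \<in> set us" "z \<in> set vs"
  shows "subseq [x, y, z] (us @ y # vs)"
  using list_emb_append_mono[of "(=)" "[x]" us "[y, z]" "y # vs"] assms
  by (auto simp: subseq_singleton_left)

text \<open>Induction on \<open>p\<close>: prepending \<open>x\<close> must preserve goodness
  exactly when \<open>x\<close> starts no 132 and no 3421. This is decided by comparing
  \<open>x\<close> with the next letter \<open>y\<close>, whose entry \<open>d\<close> is the
  largest in the code of \<open>p\<close>.\<close>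

lemma good_lehmer_code_iff:
  assumes "distinct p"
  shows "good_code (lehmer_code p) \<longleftrightarrow> avoids p [1, 3, 2] \<and> avoids p [3, 4, 2, 1]"
  using assms
proof (induction p)
  case Nil
  show ?case by (simp add: avoids_132 avoids_3421)
next
  case (Cons x p)
  note IH = Cons.IH
  show ?case
  proof (cases "good_code (lehmer_code p) \<and> p \<noteq> []")
    case False
    then show ?thesis
    proof (cases "p = []")
      case True
      then show ?thesis by (simp add: avoids_132 avoids_3421)
    qed (use Cons in \<open>auto simp: avoids_132_Cons avoids_3421_Cons\<close>)
  next
    case good: True
    with Cons have av: "avoids p [1, 3, 2]" "avoids p [3, 4, 2, 1]" by auto
    obtain y ys where p: "p = y # ys" using good by (cases p) auto
    have dist: "x \<noteq> y" "x \<notin> set ys" "y \<notin> set ys" "distinct ys" using Cons.prems p by auto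
    define c where "c = card {w \<in> set p. w < x}"
    define d where "d = card {w \<in> set ys. w < y}"
    have le_d: "b \<le> d" if "b \<in> set (lehmer_code p)" for b
      using that good good_code_imp_le_hd by (auto simp: p d_def)
    have av132: False if "subseq [a, b, e] p" "a < e" "e < b" for a b e
      using that av(1) unfolding avoids_132 by blast
    have av3421: False if "subseq [a, b, e, f] p" "f < e" "e < a" "a < b" for a b e f
      using that av(2) unfolding avoids_3421 by blast
    let ?N132 = "\<not> (\<exists>b e. subseq [b, e] p \<and> x < e \<and> e < b)"
    let ?N3421 = "\<not> (\<exists>b e f. subseq [b, e, f] p \<and> f < e \<and> e < x \<and> x < b)"
    have "(\<forall>b\<in>set (lehmer_code p). b < c) \<or> set (lehmer_code p) \<subseteq> {c, 0} \<longleftrightarrow> ?N132 \<and> ?N3421"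
    proof (cases "y < x")
      case True
      \<comment> \<open>Everything below \<open>y\<close> is below \<open>x\<close>, and
        \<open>y\<close> itself is counted for \<open>x\<close> only.\<close>
      have "d < c" unfolding c_def d_def
        by (rule psubset_card_mono) (use True dist in \<open>auto simp: p\<close>)
      then have "\<forall>b\<in>set (lehmer_code p). b < c" using le_d by fastforce
      moreover have ?N132
      proof (intro notI, elim exE conjE)
        fix b e assume *: "subseq [b, e] p" "x < e" "e < b"
        \<comment> \<open>The letter \<open>y\<close> can take over the role of \<open>x\<close> as
          the 1 of the pattern.\<close>
        then have "subseq [y, b, e] p" using True by (simp add: p split: if_splits)
        then show False using av132 * True by (meson less_trans)
      qed
      moreover have ?N3421
      proof (intro notI, elim exE conjE)
        fix b e f assume *: "subseq [b, e, f] p" "f < e" "e < x" "x < b"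
        then have s: "subseq [b, e, f] ys" using True by (simp add: p split: if_splits)
        then have "e \<in> set ys" using subseq_set by fastforce
        with dist have "e \<noteq> y" by auto
        \<comment> \<open>With \<open>y\<close> in place of \<open>x\<close>, the letters
          \<open>y\<close>, \<open>b\<close>, \<open>e\<close>, \<open>f\<close> form 3421 if
          \<open>e < y\<close>; otherwise \<open>y\<close>, \<open>b\<close>, \<open>e\<close> form
          132.\<close>
        show False
        proof (cases "e < y")
          case True
          then show False using av3421[of y b e f] s * \<open>y < x\<close> by (simp add: p)
        next
          case False
          moreover have "subseq [y, b, e] p"
            using subseq_order.order_trans[OF _ s, of "[b, e]"] by (simp add: p)
          ultimately show False using av132[of y b e] \<open>e \<noteq> y\<close> * by simp
        qed
      qed
      ultimately show ?thesis by blast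
    next
      case False
      then have xy: "x < y" using dist by simp
      have c: "c = card {w \<in> set ys. w < x}"
        unfolding c_def p using xy by (intro arg_cong[of _ _ card]) auto
      have "c \<le> d"
        unfolding c d_def by (rule card_mono) (use xy in auto)
      moreover have d_in: "d \<in> set (lehmer_code p)" by (simp add: p d_def)
      ultimately have "\<not> (\<forall>b\<in>set (lehmer_code p). b < c)" by fastforce
      moreover have "set (lehmer_code p) \<subseteq> {c, 0} \<longleftrightarrow> ?N132 \<and> ?N3421"
      proof
        assume sub: "set (lehmer_code p) \<subseteq> {c, 0}"
        then have "c = d" using d_in \<open>c \<le> d\<close> by auto
        then have eq: "{w \<in> set ys. w < x} = {w \<in> set ys. w < y}"
          using xy unfolding c d_def by (intro card_subset_eq) auto
        \<comment> \<open>Equal entries mean that no later value separates \<open>x\<close> from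
          \<open>y\<close>.\<close>
        then have between: "\<not> (x < w \<and> w < y)" if "w \<in> set ys" for w
          using that eq unfolding set_eq_iff mem_Collect_eq by (meson less_asym)
        have ?N132
        proof (intro notI, elim exE conjE)
          fix b e assume *: "subseq [b, e] p" "x < e" "e < b"
          show False
          proof (cases "b = y")
            case True
            then show ?thesis using * between by (auto simp: p subseq_singleton_left)
          next
            case False
            then have s: "subseq [b, e] ys" using * by (simp add: p)
            then have "e \<in> set ys" using subseq_set by fastforce
            then have "y < e" using between[of e] dist * by (metis linorder_neqE_nat)
            then show ?thesis using av132[of y b e] s * by (simp add: p)
          qed
        qed
        moreover have ?N3421
        proof (intro notI, elim exE conjE)
          fix b e f assume *: "subseq [b, e, f] p" "f < e" "e < x" "x < b"
          then have "subseq [e, f] ys"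
            using subseq_Cons'[of b "[e, f]" ys] by (auto simp: p split: if_splits)
          then obtain us vs where ys: "ys = us @ e # vs" "f \<in> set vs"
            by (auto simp: subseq2_iff)
          \<comment> \<open>The code entry at \<open>e\<close> is positive because of
            \<open>f\<close>, and smaller than \<open>c\<close> because everything it counts lies
            below \<open>x\<close> and \<open>e\<close> is not counted. Such an entry is neither
            \<open>c\<close> nor \<open>0\<close>.\<close>
          let ?k = "card {w \<in> set vs. w < e}"
          have "?k \<in> set (lehmer_code p)"
            by (auto simp: p in_set_lehmer_code ys)
          moreover have "?k \<noteq> 0" using ys(2) * by auto
          moreover have "?k < c" unfolding c
            by (rule psubset_card_mono) (use ys * dist in auto)
          ultimately show False using sub by auto
        qed
        ultimately show "?N132 \<and> ?N3421" by blast
      next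
        assume N: "?N132 \<and> ?N3421"
        have N132: False if "subseq [b, e] p" "x < e" "e < b" for b e
          using N that by blast
        have N3421: False if "subseq [b, e, f] p" "f < e" "e < x" "x < b" for b e f
          using N that by blast
        \<comment> \<open>Otherwise \<open>x\<close>, \<open>y\<close>, \<open>w\<close> would form
          132.\<close>
        have between: "w < x" if "w \<in> set ys" "w < y" for w
        proof (rule ccontr)
          assume "\<not> w < x"
          then have "x < w" using that dist by (metis linorder_neqE_nat)
          then show False using N132[of y w] that by (simp add: p subseq_singleton_left)
        qed
        have "d = c"
          unfolding c d_def using xy between by (intro arg_cong[of _ _ card]) auto
        moreover have "k \<in> {c, 0}" if "k \<in> set (lehmer_code ys)" for k
        proof -
          from that obtain us v vs where ys: "ys = us @ v # vs" and k: "k = card {w \<in> set vs. w < v}"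
            by (auto simp: in_set_lehmer_code)
          show ?thesis
          proof (cases "k = 0")
            case False
            then obtain w where w: "w \<in> set vs" "w < v"
              unfolding k by (metis (mono_tags, lifting) card.empty empty_Collect_eq)
            \<comment> \<open>Otherwise \<open>x\<close>, \<open>y\<close>, \<open>v\<close>,
              \<open>w\<close> would form 3421.\<close>
            have vx: "x < v"
            proof (rule ccontr)
              assume "\<not> x < v"
              then have "v < x" using dist ys by auto
              then show False
                using N3421[of y v w] w xy by (auto simp: p ys subseq2_iff)
            qed
            \<comment> \<open>Otherwise \<open>x\<close>, \<open>v\<close>, \<open>u\<close> would
              form 132.\<close>
            have small: "u < x" if u: "u \<in> set vs" "u < v" for u
            proof (rule ccontr)
              assume "\<not> u < x"
              then have "x < u" using dist ys u by auto
              moreover have "subseq [v, u] p"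
                unfolding p using u by (intro list_emb_Cons) (auto simp: ys subseq2_iff)
              ultimately show False using N132[of v u] u by simp
            qed
            have "{u \<in> set vs. u < v} = {u \<in> set ys. u < x}"
            proof (intro equalityI subsetI)
              fix u assume "u \<in> {u \<in> set vs. u < v}"
              then show "u \<in> {u \<in> set ys. u < x}" using small ys by auto
            next
              fix u assume u: "u \<in> {u \<in> set ys. u < x}"
              \<comment> \<open>If \<open>u\<close> preceded \<open>v\<close>, then
                \<open>u\<close>, \<open>v\<close>, \<open>w\<close> would form 132 when
                \<open>u < w\<close>, and \<open>x\<close>, \<open>y\<close>, \<open>u\<close>,
                \<open>w\<close> would form 3421 when \<open>w < u\<close>. Hence a nonzero entry at
                \<open>v\<close> counts exactly the letters below \<open>x\<close>, and equals
                \<open>c\<close>.\<close>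
              have "u \<in> set vs"
              proof (rule ccontr)
                assume "u \<notin> set vs"
                then have us: "u \<in> set us" using u ys vx by auto
                have "u \<noteq> w" using \<open>u \<notin> set vs\<close> w by auto
                have uvw: "subseq [u, v, w] ys"
                  using us w by (simp add: ys subseq3_append)
                have "subseq [y, u, w] p"
                  using subseq_order.order_trans[OF _ uvw, of "[u, w]"] by (simp add: p)
                moreover have "subseq [u, v, w] p"
                  unfolding p using uvw by (rule list_emb_Cons)
                ultimately show False
                  using N3421[of y u w] av132[of u v w] xy w u small[OF w] \<open>u \<noteq> w\<close>
                  by (metis linorder_neqE_nat mem_Collect_eq)
              qed
              then show "u \<in> {u \<in> set vs. u < v}" using u vx by auto
            qed
            then show ?thesis using k c by simp
          qed simp
        qed
        ultimately show "set (lehmer_code p) \<subseteq> {c, 0}"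
          by (auto simp: p d_def)
      qed
      ultimately show ?thesis by blast
    qed
    then show ?thesis
      using good IH Cons.prems av by (simp add: avoids_132_Cons avoids_3421_Cons c_def)
  qed
qed

section \<open>Generating function of the good codes\<close>

text \<open>Good codes are weakly decreasing, so each partition is represented by one list. With
  \<open>0\<close> excluded as a part, only the smallest part can repeat.\<close>

definition good_partitions :: "nat \<Rightarrow> nat \<Rightarrow> nat list set" where
  "good_partitions N i = {l. good_code l \<and> set l \<subseteq> {1..N} \<and> sum_list l = i}"

lemma length_le_sum_list:
  fixes l :: "nat list"
  assumes "0 \<notin> set l"
  shows "length l \<le> sum_list l"
  using assms by (induction l) auto

lemma finite_good_partitions [simp]: "finite (good_partitions N i)"
proof (rule finite_subset)
  show "good_partitions N i \<subseteq> {l. set l \<subseteq> {1..N} \<and> length l \<le> i}"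
    by (auto simp: good_partitions_def intro!: length_le_sum_list)
qed (simp add: finite_lists_length_le)

text \<open>No part exceeds the sum, so a bound of at least \<open>i\<close> on the parts is no
  restriction.\<close>

lemma good_partitions_eq:
  assumes "i \<le> N"
  shows "good_partitions N i = good_partitions i i"
proof -
  have "set l \<subseteq> {1..i}" if "l \<in> good_partitions N i" for l
    using that member_le_sum_list[of _ l] by (auto simp: good_partitions_def)
  then show ?thesis using assms by (fastforce simp: good_partitions_def)
qed

lemma good_partitions_0: "good_partitions 0 i = (if i = 0 then {[]} else {})"
  by (auto simp: good_partitions_def)

lemma good_code_replicate: "good_code (replicate m a)"
  by (induction m) auto

text \<open>The part \<open>Suc N\<close> is absent, occurs once at the head, or is repeated. In the
  last case it is also the smallest part, so all parts equal it; the condition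
  \<open>2 * Suc N \<le> i\<close> keeps this case apart from the second.\<close>

lemma good_partitions_Suc:
  "good_partitions (Suc N) i = good_partitions N i
     \<union> Cons (Suc N) ` (if Suc N \<le> i then good_partitions N (i - Suc N) else {})
     \<union> (if Suc N dvd i \<and> 2 * Suc N \<le> i then {replicate (i div Suc N) (Suc N)} else {})"
  (is "_ = ?A \<union> ?B \<union> ?C")
proof (intro equalityI subsetI)
  fix l assume l: "l \<in> good_partitions (Suc N) i"
  show "l \<in> ?A \<union> ?B \<union> ?C"
  proof (cases "Suc N \<in> set l")
    case False
    then have "set l \<subseteq> {1..N}" using l by (fastforce simp: good_partitions_def le_Suc_eq)
    then show ?thesis using l by (auto simp: good_partitions_def)
  next
    case True
    then obtain a l' where al: "l = a # l'" by (cases l) auto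
    have "Suc N \<le> a"
      using True l good_code_imp_le_hd[of a l' "Suc N"] by (auto simp: al good_partitions_def)
    then have a: "a = Suc N" using l by (auto simp: al good_partitions_def)
    show ?thesis
    proof (cases "\<forall>b\<in>set l'. b < a")
      case True
      then have "set l' \<subseteq> {1..N}"
        using l by (fastforce simp: good_partitions_def al a less_Suc_eq_le)
      then have "l' \<in> good_partitions N (i - Suc N)"
        using l by (auto simp: good_partitions_def al a)
      moreover have "Suc N \<le> i" using l by (auto simp: good_partitions_def al a)
      ultimately show ?thesis by (simp add: al a)
    next
      case False
      then have "l' \<noteq> []" "set l' \<subseteq> {a}"
        using l by (auto simp: good_partitions_def al)
      then obtain m where m: "l' = replicate (Suc m) a"
        by (metis length_0_conv not0_implies_Suc replicate_eqI singletonD subsetD)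
      then have i: "i = Suc (Suc m) * Suc N" using l by (simp add: good_partitions_def al a sum_list_replicate)
      have "Suc N dvd i" unfolding i by (rule dvd_triv_right)
      moreover have "i div Suc N = Suc (Suc m)"
        unfolding i by (rule nonzero_mult_div_cancel_right) simp
      moreover have "2 * Suc N \<le> i" unfolding i by (rule mult_le_mono1) simp
      ultimately have "l \<in> ?C" by (simp add: al m a del: mult_Suc_right)
      then show ?thesis by blast
    qed
  qed
next
  fix l assume "l \<in> ?A \<union> ?B \<union> ?C"
  then consider "l \<in> ?A" | "l \<in> ?B" | "l \<in> ?C" by blast
  then show "l \<in> good_partitions (Suc N) i"
  proof cases
    case 2
    then show ?thesis by (fastforce simp: good_partitions_def split: if_splits)
  qed (auto simp: good_partitions_def good_code_replicate sum_list_replicate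
      simp del: mult_Suc_right split: if_splits)
qed

lemma card_good_partitions_Suc:
  "card (good_partitions (Suc N) i) = card (good_partitions N i)
     + (if Suc N \<le> i then card (good_partitions N (i - Suc N)) else 0)
     + (if Suc N dvd i \<and> 2 * Suc N \<le> i then 1 else 0)"
proof -
  let ?B = "Cons (Suc N) ` (if Suc N \<le> i then good_partitions N (i - Suc N) else {})"
  let ?C = "if Suc N dvd i \<and> 2 * Suc N \<le> i then {replicate (i div Suc N) (Suc N)} else {}"
  have notin: "Suc N \<notin> set l" if "l \<in> good_partitions N j" for l j
    using that by (auto simp: good_partitions_def)
  have disj: "good_partitions N i \<inter> ?B = {}"
    using notin by (fastforce split: if_splits)
  have disj': "(good_partitions N i \<union> ?B) \<inter> ?C = {}"
  proof (cases "2 * Suc N \<le> i")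
    case True
    have "2 \<le> i div Suc N" using True by (simp add: less_eq_div_iff_mult_less_eq)
    then obtain m where "i div Suc N = Suc (Suc m)"
      by (metis Suc_le_D numeral_2_eq_2 Suc_le_mono)
    then have "replicate (i div Suc N) (Suc N) = Suc N # Suc N # replicate m (Suc N)"
      by simp
    then have "replicate (i div Suc N) (Suc N) \<notin> good_partitions N i \<union> ?B"
      using notin[of "Suc N # replicate m (Suc N)"] notin[of "Suc N # Suc N # replicate m (Suc N)"]
      by auto
    then show ?thesis by (auto split: if_splits)
  qed simp
  have fin: "finite ?B" "finite ?C" by simp_all
  have "card (good_partitions N i \<union> ?B \<union> ?C) = card (good_partitions N i) + card ?B + card ?C"
    using disj disj' fin by (simp only: card_Un_disjoint finite_Un finite_good_partitions)
  moreover have "card ?B = (if Suc N \<le> i then card (good_partitions N (i - Suc N)) else 0)"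
    by (simp add: card_image)
  moreover have "card ?C = (if Suc N dvd i \<and> 2 * Suc N \<le> i then 1 else 0)"
    by simp
  ultimately show ?thesis by (simp only: good_partitions_Suc)
qed

section \<open>Power series: geometric factors, truncations and limits\<close>

lemma fps_X_power_div_one_minus_nth:
  assumes "m > 0"
  shows "fps_nth (fps_X ^ m / (1 - fps_X ^ m) :: 'a :: field fps) i = (if m dvd i \<and> i > 0 then 1 else 0)"
proof -
  define F :: "'a fps" where "F = Abs_fps (\<lambda>i. if m dvd i \<and> i > 0 then 1 else 0)"
  \<comment> \<open>The quotient is identified by clearing the denominator, which is nonzero since
    its constant term is \<open>1\<close>.\<close>
  have "F * (1 - fps_X ^ m) = fps_X ^ m"
    using assms
    by (intro fps_ext)
      (auto simp: F_def algebra_simps fps_X_power_mult_nth dvd_minus_self dvd_imp_le)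
  moreover have "fps_nth (1 - fps_X ^ m :: 'a fps) 0 = 1" using assms by simp
  then have "(1 - fps_X ^ m :: 'a fps) \<noteq> 0" by force
  ultimately have "fps_X ^ m / (1 - fps_X ^ m) = F"
    by (metis nonzero_mult_div_cancel_right)
  then show ?thesis by (simp add: F_def)
qed

text \<open>Indices start at \<open>0\<close>: \<open>k\<close> stands for the smallest part
  \<open>k + 1\<close>, taken with any positive multiplicity.\<close>

abbreviation (input) part_gf :: "nat \<Rightarrow> rat fps" where
  "part_gf k \<equiv> fps_X ^ (k + 1) / (1 - fps_X ^ (k + 1))"

text \<open>The larger parts, each used at most once: the exponents run from \<open>k + 2\<close> to
  \<open>N\<close>.\<close>

abbreviation (input) distinct_gf :: "nat \<Rightarrow> nat \<Rightarrow> rat fps" where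
  "distinct_gf k N \<equiv> (\<Prod>j=k + 1..<N. 1 + fps_X ^ (j + 1))"

text \<open>The summand \<open>k\<close> accounts for smallest part \<open>k + 1\<close>, and
  \<open>1\<close> for the empty partition. The proof checks that both sides satisfy the same
  recursion in \<open>N\<close>.\<close>

lemma good_partitions_gf:
  "fps_nth (1 + (\<Sum>k<N. part_gf k * distinct_gf k N)) i = of_nat (card (good_partitions N i))"
proof (induction N arbitrary: i)
  case 0
  then show ?case by (simp add: good_partitions_0)
next
  case (Suc N)
  define A where "A = 1 + (\<Sum>k<N. part_gf k * distinct_gf k N)"
  have IH: "fps_nth A j = of_nat (card (good_partitions N j))" for j
    using Suc.IH by (simp only: A_def)
  \<comment> \<open>Each old product gains one factor, and the new summand has an empty
    product.\<close>
  have "1 + (\<Sum>k<Suc N. part_gf k * distinct_gf k (Suc N))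
      = 1 + (A - 1) * (1 + fps_X ^ (N + 1)) + part_gf N"
    by (simp add: A_def sum_distrib_right mult.assoc)
  also have "\<dots> = A + A * fps_X ^ (N + 1) - fps_X ^ (N + 1) + part_gf N"
    by (simp add: algebra_simps)
  also have "fps_nth \<dots> i = fps_nth A i + (if i < Suc N then 0 else fps_nth A (i - Suc N))
      - (if i = Suc N then 1 else 0) + (if Suc N dvd i \<and> i > 0 then 1 else 0)"
    using fps_X_power_div_one_minus_nth[of "N + 1" i, where ?'a = rat]
    unfolding Suc_eq_plus1 by (simp add: fps_X_power_mult_right_nth)
  \<comment> \<open>The first term of the geometric series cancels against
    \<open>- fps_X ^ (N + 1)\<close>: the single part \<open>N + 1\<close> is already counted by
    \<open>A * fps_X ^ (N + 1)\<close>.\<close>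
  also have "(if Suc N dvd i \<and> i > 0 then 1 else 0) =
      (if i = Suc N then 1 else 0) + (if Suc N dvd i \<and> 2 * Suc N \<le> i then 1 else 0 :: rat)"
  proof -
    have "2 * Suc N \<le> i" if "Suc N dvd i" "i > 0" "i \<noteq> Suc N"
    proof -
      from that obtain q where q: "i = Suc N * q" by (elim dvdE)
      with that have "2 \<le> q" by (cases q) auto
      then show ?thesis unfolding q by (metis mult.commute mult_le_mono1)
    qed
    then show ?thesis by auto
  qed
  finally show ?case
    by (simp only: IH card_good_partitions_Suc) auto
qed

text \<open>Factors added from \<open>N = n\<close> on have the form
  \<open>1 + fps_X ^ (N + 1)\<close> with exponent above \<open>n\<close>, and do not reach the
  coefficient \<open>n\<close>.\<close>

lemma distinct_gf_nth_stable:
  assumes "n \<le> N"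
  shows "fps_nth (distinct_gf k N) n = fps_nth (distinct_gf k n) n"
  using assms
proof (induction N rule: dec_induct)
  case (step N)
  show ?case
  proof (cases "k + 1 \<le> N")
    case True
    have "fps_nth (distinct_gf k N * (1 + fps_X ^ (N + 1))) n = fps_nth (distinct_gf k N) n"
      using step(1) by (simp add: distrib_left fps_X_power_mult_right_nth del: power_Suc)
    then show ?thesis using True step.IH by (simp add: prod.atLeastLessThan_Suc)
  qed (use step in simp)
qed simp

text \<open>The partial products converge because each coefficient is eventually constant. The
  truncation \<open>N\<close> is free above \<open>n\<close>, so that one \<open>N\<close> serves
  all summands later.\<close>

lemma prodinf_distinct_nth:
  assumes "n \<le> N"
  shows "fps_nth (\<Prod>i. 1 + fps_X ^ (i + (k + 1) + 1)) n = fps_nth (distinct_gf k N) n"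
proof -
  \<comment> \<open>The diagonal works as the limit since coefficient \<open>n\<close> has settled
    at truncation \<open>n\<close>.\<close>
  define L where "L = Abs_fps (\<lambda>n. fps_nth (distinct_gf k n) n)"
  have partial: "(\<Prod>i\<le>M. 1 + fps_X ^ (i + (k + 1) + 1)) = distinct_gf k (M + k + 2)" for M
  proof (induction M)
    case 0
    have "{k + 1..<0 + k + 2} = {k + 1}" by auto
    then show ?case by simp
  next
    case (Suc M)
    have "distinct_gf k (Suc M + k + 2) = distinct_gf k (M + k + 2) * (1 + fps_X ^ (M + k + 2 + 1))"
      using prod.atLeastLessThan_Suc[of "k + 1" "M + k + 2"] by simp
    moreover have "Suc M + (k + 1) + 1 = M + k + 2 + 1" by simp
    ultimately show ?case using Suc by (simp only: prod.atMost_Suc)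
  qed
  have "(\<lambda>M. \<Prod>i\<le>M. 1 + fps_X ^ (i + (k + 1) + 1)) \<longlonglongrightarrow> L"
  proof (rule tendsto_fpsI)
    fix n
    show "\<forall>\<^sub>F M in sequentially. fps_nth (\<Prod>i\<le>M. 1 + fps_X ^ (i + (k + 1) + 1)) n = fps_nth L n"
      using eventually_ge_at_top[of n]
    proof eventually_elim
      case (elim M)
      then show ?case unfolding partial by (subst distinct_gf_nth_stable) (auto simp: L_def)
    qed
  qed
  \<comment> \<open>Convergence in the sense of \<open>has_prod\<close> demands a nonzero
    limit.\<close>
  moreover have "fps_nth L 0 \<noteq> 0" by (simp add: L_def)
  then have "L \<noteq> 0" by force
  ultimately have "(\<lambda>i. 1 + fps_X ^ (i + (k + 1) + 1)) has_prod L"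
    by (simp add: has_prod_def raw_has_prod_def)
  then have "(\<Prod>i. 1 + fps_X ^ (i + (k + 1) + 1)) = L"
    by (rule has_prod_unique[symmetric])
  then show ?thesis using distinct_gf_nth_stable[OF assms] by (simp add: L_def)
qed

lemma suminf_good_partitions:
  "1 + (\<Sum>k. part_gf k * (\<Prod>i. 1 + fps_X ^ (i + (k + 1) + 1)))
     = Abs_fps (\<lambda>n. of_nat (card (good_partitions n n)))" (is "1 + suminf ?f = ?G")
proof -
  have "?f sums (?G - 1)"
    unfolding sums_def
  proof (rule tendsto_fpsI)
    fix n
    show "\<forall>\<^sub>F N in sequentially. fps_nth (\<Sum>k<N. ?f k) n = fps_nth (?G - 1) n"
      using eventually_ge_at_top[of n]
    proof eventually_elim
      case (elim N)
      \<comment> \<open>Coefficient \<open>n\<close> of a product involves only coefficients up to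
        \<open>n \<le> N\<close>, where the infinite product agrees with its truncation.\<close>
      have "fps_nth (?f k) n = fps_nth (part_gf k * distinct_gf k N) n" for k
        unfolding fps_mult_nth using elim by (intro sum.cong) (auto simp: prodinf_distinct_nth[of _ N])
      then have "fps_nth (\<Sum>k<N. ?f k) n
          = fps_nth (1 + (\<Sum>k<N. part_gf k * distinct_gf k N)) n - fps_nth 1 n"
        by (simp add: fps_sum_nth)
      then show ?case
        using elim good_partitions_eq[of n N] by (simp only: good_partitions_gf) simp
    qed
  qed
  then show ?thesis by (simp add: sums_iff)
qed

section \<open>Padding partitions with zeros to codes of fixed length\<close>

lemma good_code_append_zeros:
  assumes "0 \<notin> set l"
  shows "good_code (l @ replicate m 0) \<longleftrightarrow> good_code l"
  using assms
proof (induction l)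
  case (Cons a l)
  then show ?case by (cases m) auto
qed (simp add: good_code_replicate)

text \<open>A good code is weakly decreasing, so its zeros form a suffix.\<close>

lemma good_code_decomp:
  assumes "good_code c"
  shows "c = filter (\<lambda>x. x \<noteq> 0) c @ replicate (length c - length (filter (\<lambda>x. x \<noteq> 0) c)) 0"
  using assms
proof (induction c)
  case (Cons a c)
  show ?case
  proof (cases "a = 0")
    case True
    then have "set c \<subseteq> {0}" using Cons.prems by auto
    then have "filter (\<lambda>x. x \<noteq> 0) c = []" "c = replicate (length c) 0"
      by (auto simp: filter_empty_conv intro!: replicate_eqI)
    then show ?thesis using True by simp
  next
    case False
    then show ?thesis using Cons by simp
  qed
qed simp

text \<open>A partition of \<open>i\<close> has at most \<open>i\<close> parts, so it fits into
  length \<open>h\<close>; deleting the zeros and padding with zeros are mutually inverse.\<close>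

lemma bij_betw_filter_good_code:
  assumes "i < h"
  shows "bij_betw (filter (\<lambda>x. x \<noteq> 0)) {c. length c = h \<and> good_code c \<and> sum_list c = i}
           (good_partitions i i)"
proof (rule bij_betw_byWitness)
  let ?D = "{c. length c = h \<and> good_code c \<and> sum_list c = i}"
  let ?pad = "\<lambda>l. l @ replicate (h - length l) (0 :: nat)"
  have zero: "0 \<notin> set l" "length l \<le> h" if "l \<in> good_partitions i i" for l
  proof -
    show "0 \<notin> set l" using that by (auto simp: good_partitions_def)
    then show "length l \<le> h"
      using that assms length_le_sum_list[of l] by (simp add: good_partitions_def)
  qed
  show "\<forall>c\<in>?D. ?pad (filter (\<lambda>x. x \<noteq> 0) c) = c"
    using good_code_decomp by force
  show "\<forall>l\<in>good_partitions i i. filter (\<lambda>x. x \<noteq> 0) (?pad l) = l"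
  proof
    fix l assume "l \<in> good_partitions i i"
    then have "filter (\<lambda>x. x \<noteq> 0) l = l" using zero(1) by (intro filter_True) metis
    then show "filter (\<lambda>x. x \<noteq> 0) (?pad l) = l" by simp
  qed
  show "?pad ` good_partitions i i \<subseteq> ?D"
    using zero by (auto simp: good_code_append_zeros) (auto simp: good_partitions_def sum_list_replicate)
  show "filter (\<lambda>x. x \<noteq> 0) ` ?D \<subseteq> good_partitions i i"
  proof (intro image_subsetI)
    fix c assume c: "c \<in> ?D"
    let ?l = "filter (\<lambda>x. x \<noteq> 0) c"
    have "good_code (?l @ replicate (length c - length ?l) 0)"
      using c by (subst good_code_decomp[symmetric]) auto
    then have "good_code ?l" by (simp add: good_code_append_zeros)
    moreover have "sum_list ?l = sum_list c"
      by (induction c) auto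
    moreover have "set ?l \<subseteq> {1..i}"
      using c member_le_sum_list[of _ c] by (auto simp: Suc_le_eq)
    ultimately show "?l \<in> good_partitions i i" using c by (simp add: good_partitions_def)
  qed
qed

lemma card_avoiders_132_3421:
  assumes "i < h"
  shows "av h i {[1, 3, 2], [3, 4, 2, 1]} = card (good_partitions i i)"
proof -
  let ?S = "{p \<in> permutations_of_set {1..h}. card (inversions p) = i \<and>
     (\<forall>q\<in>{[1, 3, 2], [3, 4, 2, 1]}. avoids p q)}"
  let ?D = "{c. length c = h \<and> good_code c \<and> sum_list c = i}"
  have bij: "bij_betw lehmer_code (permutations_of_set {1..h}) {c. length c = h \<and> valid_code c}"
    using bij_betw_lehmer_code[of "{1..h}"] by simp
  have S: "?S = {p \<in> permutations_of_set {1..h}. lehmer_code p \<in> ?D}"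
  proof (rule Collect_cong, rule conj_cong[OF refl])
    fix p assume p: "p \<in> permutations_of_set {1..h}"
    show "card (inversions p) = i \<and> (\<forall>q\<in>{[1, 3, 2], [3, 4, 2, 1]}. avoids p q)
        \<longleftrightarrow> lehmer_code p \<in> ?D"
      using card_inversions[of p] good_lehmer_code_iff[of p] permutations_of_setD(2)[OF p]
        length_finite_permutations_of_set[OF p] by auto
  qed
  have image_eq: "f ` {x \<in> X. f x \<in> Y} = f ` X \<inter> Y"
    for f :: "nat list \<Rightarrow> nat list" and X Y
    by blast
  \<comment> \<open>Here \<open>i < h\<close> enters: every good code of sum \<open>i\<close> is the
    code of some permutation.\<close>
  have "?D \<subseteq> {c. length c = h \<and> valid_code c}"
    using good_code_imp_valid assms by auto
  then have image: "lehmer_code ` ?S = ?D"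
    using bij_betw_imp_surj_on[OF bij] unfolding S image_eq by (simp only: Int_absorb1)
  have "inj_on lehmer_code ?S"
    using bij_betw_imp_inj_on[OF bij] by (rule inj_on_subset) auto
  from card_image[OF this] have "card ?S = card ?D"
    unfolding image by (rule sym)
  also have "\<dots> = card (good_partitions i i)"
    by (rule bij_betw_same_card[OF bij_betw_filter_good_code[OF assms]])
  finally show ?thesis by (simp only: av_def)
qed

section \<open>Symmetry between 132 and 213\<close>

text \<open>
  The inverse of the reverse-complement: a point of the diagram at (zero-based) position \<open>i\<close>
  with value \<open>p ! i\<close> moves to position \<open>n - p ! i\<close> with value \<open>n - i\<close>.
\<close>

definition rci :: "nat list \<Rightarrow> nat list" where
  "rci p = map (\<lambda>t. length p - inv_into {..<length p} ((!) p) (length p - t)) [0..<length p]"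

context
  fixes p :: "nat list" and n :: nat
  assumes p: "p \<in> permutations_of_set {1..n}"
begin

lemma length_perm: "length p = n"
  using length_finite_permutations_of_set[OF p] by simp

lemma nth_perm_image: "(!) p ` {..<n} = {1..n}"
  using permutations_of_setD(1)[OF p] length_perm by (auto simp: set_conv_nth)

lemma inj_on_nth_perm: "inj_on ((!) p) {..<n}"
  using permutations_of_setD(2)[OF p] length_perm by (auto simp: inj_on_def nth_eq_iff_index_eq)

lemma nth_perm_bounds:
  assumes "i < n"
  shows "0 < p ! i" "p ! i \<le> n"
  using nth_perm_image assms by fastforce+

lemma nth_perm_neq:
  assumes "i < n" "j < n" "i \<noteq> j"
  shows "p ! i \<noteq> p ! j"
  using inj_on_nth_perm assms by (auto simp: inj_on_def)

text \<open>The pointwise description of \<open>rci\<close>; the transfer of patterns and inversions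
  rests on it rather than on \<open>inv_into\<close>.\<close>

lemma rci_nth:
  assumes "i < n"
  shows "n - p ! i < n" "rci p ! (n - p ! i) = n - i"
proof -
  show "n - p ! i < n" using nth_perm_bounds[OF assms] by simp
  then show "rci p ! (n - p ! i) = n - i"
    using nth_perm_bounds[OF assms] inj_on_nth_perm assms
    by (simp add: rci_def length_perm inv_into_f_f)
qed

lemma length_rci: "length (rci p) = n"
  by (simp add: rci_def length_perm)

lemma rci_perm: "rci p \<in> permutations_of_set {1..n}"
proof -
  have "set (rci p) = {1..n}"
  proof
    show "set (rci p) \<subseteq> {1..n}"
    proof
      fix v assume "v \<in> set (rci p)"
      then obtain t where t: "t < n" "v = n - inv_into {..<n} ((!) p) (n - t)"
        by (auto simp: rci_def length_perm)
      then have "n - t \<in> (!) p ` {..<n}" unfolding nth_perm_image by auto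
      from inv_into_into[OF this] show "v \<in> {1..n}" using t by auto
    qed
    show "{1..n} \<subseteq> set (rci p)"
    proof
      fix v assume "v \<in> {1..n}"
      then have "n - v < n" "n - (n - v) = v" by auto
      with rci_nth[of "n - v"] show "v \<in> set (rci p)"
        by (metis length_rci nth_mem)
    qed
  qed
  moreover have "distinct (rci p)"
    using calculation by (intro card_distinct) (simp add: length_rci)
  ultimately show ?thesis by auto
qed

text \<open>An occurrence at \<open>i\<close>, \<open>j\<close>, \<open>k\<close> turns into one
  read in the order \<open>k\<close>, \<open>i\<close>, \<open>j\<close>, with values
  \<open>n - k\<close>, \<open>n - i\<close>, \<open>n - j\<close>. Containment is transferred in
  one direction only; \<open>rci_rci\<close> supplies the converse.\<close>

lemma rci_contains_132:
  assumes "\<not> avoids p [2, 1, 3]"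
  shows "\<not> avoids (rci p) [1, 3, 2]"
proof -
  from assms obtain i j k where *: "i < j" "j < k" "k < n" "p ! j < p ! i" "p ! i < p ! k"
    unfolding avoids_213_nth length_perm by blast
  then have lt: "i < n" "j < n" "k < n" by auto
  have "n - p ! k < n - p ! i" "n - p ! i < n - p ! j"
    using * nth_perm_bounds(2)[OF lt(1)] nth_perm_bounds(2)[OF lt(3)] by simp_all
  moreover have "rci p ! (n - p ! k) < rci p ! (n - p ! j)"
    "rci p ! (n - p ! j) < rci p ! (n - p ! i)"
    using * lt by (simp_all add: rci_nth)
  moreover have "n - p ! j < n" using lt by (simp add: rci_nth)
  ultimately show ?thesis
    unfolding avoids_132_nth length_rci by blast
qed

lemma rci_contains_213:
  assumes "\<not> avoids p [1, 3, 2]"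
  shows "\<not> avoids (rci p) [2, 1, 3]"
proof -
  from assms obtain i j k where *: "i < j" "j < k" "k < n" "p ! i < p ! k" "p ! k < p ! j"
    unfolding avoids_132_nth length_perm by blast
  then have lt: "i < n" "j < n" "k < n" by auto
  have "n - p ! j < n - p ! k" "n - p ! k < n - p ! i"
    using * nth_perm_bounds(2)[OF lt(2)] nth_perm_bounds(2)[OF lt(3)] by simp_all
  moreover have "rci p ! (n - p ! k) < rci p ! (n - p ! j)"
    "rci p ! (n - p ! j) < rci p ! (n - p ! i)"
    using * lt by (simp_all add: rci_nth)
  moreover have "n - p ! i < n" using lt by (simp add: rci_nth)
  ultimately show ?thesis
    unfolding avoids_213_nth length_rci by blast
qed

lemma rci_contains_3421:
  assumes "\<not> avoids p [3, 4, 2, 1]"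
  shows "\<not> avoids (rci p) [3, 4, 2, 1]"
proof -
  from assms obtain i j k l where *: "i < j" "j < k" "k < l" "l < n"
    "p ! l < p ! k" "p ! k < p ! i" "p ! i < p ! j"
    unfolding avoids_3421_nth length_perm by blast
  then have lt: "i < n" "j < n" "k < n" "l < n" by auto
  have "n - p ! j < n - p ! i" "n - p ! i < n - p ! k" "n - p ! k < n - p ! l"
    using * nth_perm_bounds(2)[OF lt(1)] nth_perm_bounds(2)[OF lt(2)] nth_perm_bounds(2)[OF lt(3)]
    by simp_all
  moreover have "rci p ! (n - p ! l) < rci p ! (n - p ! k)"
    "rci p ! (n - p ! k) < rci p ! (n - p ! j)"
    "rci p ! (n - p ! j) < rci p ! (n - p ! i)"
    using * lt by (simp_all add: rci_nth)
  moreover have "n - p ! l < n" using lt by (simp add: rci_nth)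
  ultimately show ?thesis
    unfolding avoids_3421_nth length_rci by blast
qed

text \<open>Moving both points of an inversion yields an inversion again. Equality follows later by
  applying this to \<open>rci p\<close> as well.\<close>

lemma card_inversions_rci_ge: "card (inversions p) \<le> card (inversions (rci p))"
proof (rule card_inj_on_le)
  let ?f = "\<lambda>(i, j). (n - p ! i, n - p ! j)"
  show "inj_on ?f (inversions p)"
  proof (rule inj_onI)
    fix x y assume x: "x \<in> inversions p" and y: "y \<in> inversions p" and eq: "?f x = ?f y"
    obtain a b c d where [simp]: "x = (a, b)" "y = (c, d)" by force
    have lt: "a < n" "b < n" "c < n" "d < n"
      using x y by (auto simp: inversions_def length_perm)
    have "p ! a = p ! c" "p ! b = p ! d"
      using eq lt nth_perm_bounds[of a] nth_perm_bounds[of b] nth_perm_bounds[of c] nth_perm_bounds[of d]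
      by auto
    then show "x = y" using nth_perm_neq lt by auto
  qed
  show "?f ` inversions p \<subseteq> inversions (rci p)"
  proof clarify
    fix i j assume "(i, j) \<in> inversions p"
    then have "i < j" "j < n" "i < n" "p ! j < p ! i"
      by (auto simp: inversions_def length_perm)
    then show "(n - p ! i, n - p ! j) \<in> inversions (rci p)"
      using rci_nth[of i] rci_nth[of j] nth_perm_bounds[of i] by (auto simp: inversions_def length_rci)
  qed
qed simp

end

lemma rci_rci:
  assumes "p \<in> permutations_of_set {1..n}"
  shows "rci (rci p) = p"
proof (rule nth_equalityI)
  note q = rci_perm[OF assms]
  show "length (rci (rci p)) = length p"
    using length_rci[OF q] length_perm[OF assms] by simp
  fix i assume "i < length (rci (rci p))"
  then have i: "i < n" using length_rci[OF q] by simp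
  then have "rci (rci p) ! (n - rci p ! (n - p ! i)) = n - (n - p ! i)"
    by (intro rci_nth(2)[OF q] rci_nth(1)[OF assms])
  then show "rci (rci p) ! i = p ! i"
    using i rci_nth[OF assms i] nth_perm_bounds[OF assms i] by simp
qed

lemma av_213_3421: "av n k {[2, 1, 3], [3, 4, 2, 1]} = av n k {[1, 3, 2], [3, 4, 2, 1]}"
proof -
  let ?S = "\<lambda>q. {p \<in> permutations_of_set {1..n}. card (inversions p) = k \<and>
     (\<forall>q\<in>{q, [3, 4, 2, 1]}. avoids p q)}"
  have inv: "card (inversions (rci p)) = card (inversions p)" if p: "p \<in> permutations_of_set {1..n}" for p
    using card_inversions_rci_ge[OF p] card_inversions_rci_ge[OF rci_perm[OF p]] rci_rci[OF p] by simp
  have "bij_betw rci (?S [2, 1, 3]) (?S [1, 3, 2])"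
  proof (rule bij_betw_byWitness[of _ rci])
    show "rci ` ?S [2, 1, 3] \<subseteq> ?S [1, 3, 2]"
    proof (intro image_subsetI)
      fix p assume p: "p \<in> ?S [2, 1, 3]"
      then show "rci p \<in> ?S [1, 3, 2]"
        using rci_contains_213[OF rci_perm, of p n] rci_contains_3421[OF rci_perm, of p n]
          rci_perm[of p n] inv[of p] rci_rci[of p n] by auto
    qed
    show "rci ` ?S [1, 3, 2] \<subseteq> ?S [2, 1, 3]"
    proof (intro image_subsetI)
      fix p assume p: "p \<in> ?S [1, 3, 2]"
      then show "rci p \<in> ?S [2, 1, 3]"
        using rci_contains_132[OF rci_perm, of p n] rci_contains_3421[OF rci_perm, of p n]
          rci_perm[of p n] inv[of p] rci_rci[of p n] by auto
    qed
  qed (auto intro: rci_rci)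
  then show ?thesis unfolding av_def by (rule bij_betw_same_card)
qed

section \<open>Direct sums\<close>

lemma avoider_1324_split:
  assumes p: "p \<in> permutations_of_set {1..n}" and av: "avoids p [1, 3, 2, 4]"
    and h: "card (inversions p) < h" "card (inversions p) < n - h"
    and ij: "i < h" "h \<le> j" "j < n"
  shows "p ! i < p ! j"
proof (rule ccontr)
  note neq = nth_perm_neq[OF p]
  assume "\<not> p ! i < p ! j"
  then have inv: "p ! j < p ! i" using neq[of i j] ij by force
  have "\<exists>a<i. p ! a < p ! j"
  proof (rule ccontr)
    assume none: "\<not> (\<exists>a<i. p ! a < p ! j)"
    \<comment> \<open>Each of the \<open>j \<ge> h\<close> positions before \<open>j\<close> is
      charged with its own inversion, too many for the first bound.\<close>
    let ?f = "\<lambda>a. if p ! j < p ! a then (a, j) else (i, a)"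
    have "inj_on ?f {..<j}" by (auto simp: inj_on_def)
    moreover have "?f ` {..<j} \<subseteq> inversions p"
    proof (intro image_subsetI)
      fix a assume a: "a \<in> {..<j}"
      show "?f a \<in> inversions p"
      proof (cases "p ! j < p ! a")
        case True
        then show ?thesis using a ij by (auto simp: inversions_def length_perm[OF p])
      next
        case False
        then have "p ! a < p ! j" using neq[of a j] a ij by force
        moreover from this have "i < a" using none inv by (metis linorder_neqE_nat less_asym)
        ultimately show ?thesis
          using a ij inv False by (auto simp: inversions_def length_perm[OF p])
      qed
    qed
    ultimately have "card {..<j} \<le> card (inversions p)" by (rule card_inj_on_le) simp
    then show False using h(1) ij by simp
  qed
  then obtain a where a: "a < i" "p ! a < p ! j" by blast
  have "\<exists>b<n. j < b \<and> p ! i < p ! b"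
  proof (rule ccontr)
    assume none: "\<not> (\<exists>b<n. j < b \<and> p ! i < p ! b)"
    \<comment> \<open>The mirror image: \<open>n - i - 1 \<ge> n - h\<close> positions after
      \<open>i\<close> contradict the second bound.\<close>
    let ?f = "\<lambda>b. if p ! b < p ! i then (i, b) else (b, j)"
    have "inj_on ?f {i<..<n}" by (auto simp: inj_on_def)
    moreover have "?f ` {i<..<n} \<subseteq> inversions p"
    proof (intro image_subsetI)
      fix b assume b: "b \<in> {i<..<n}"
      show "?f b \<in> inversions p"
      proof (cases "p ! b < p ! i")
        case True
        then show ?thesis using b ij by (auto simp: inversions_def length_perm[OF p])
      next
        case False
        then have "p ! i < p ! b" using neq[of b i] b ij by force
        moreover from this have "b < j" using none inv b by (metis greaterThanLessThan_iff linorder_neqE_nat less_asym)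
        ultimately show ?thesis
          using b ij inv False by (auto simp: inversions_def length_perm[OF p])
      qed
    qed
    ultimately have "card {i<..<n} \<le> card (inversions p)" by (rule card_inj_on_le) simp
    then show False using h(2) ij by simp
  qed
  \<comment> \<open>The positions \<open>a\<close>, \<open>i\<close>, \<open>j\<close>,
    \<open>b\<close> now carry a 1324.\<close>
  then obtain b where "b < n" "j < b" "p ! i < p ! b" by blast
  moreover have "i < j" using ij by simp
  ultimately show False
    using av a inv unfolding avoids_1324_nth length_perm[OF p] by blast
qed

section \<open>The direct sum \<open>s \<oplus> t\<close>\<close>

definition join :: "nat list \<Rightarrow> nat list \<Rightarrow> nat list" where
  "join s t = s @ map ((+) (length s)) t"

lemma join_perm:
  assumes "s \<in> permutations_of_set {1..h}" "t \<in> permutations_of_set {1..m}"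
  shows "join s t \<in> permutations_of_set {1..h + m}"
proof -
  note D = permutations_of_setD[OF assms(1)] permutations_of_setD[OF assms(2)] length_perm[OF assms(1)]
  have shift: "(+) h ` {1..m} = {h + 1..h + m}" by simp
  show ?thesis
  proof (rule permutations_of_setI)
    show "set (join s t) = {1..h + m}"
      unfolding join_def using D shift by (simp only: set_append set_map) auto
    show "distinct (join s t)"
      unfolding join_def using D shift
      by (simp only: distinct_append set_map distinct_map) (auto simp: inj_on_def)
  qed
qed

lemma lehmer_code_join:
  assumes "s \<in> permutations_of_set {1..h}" "t \<in> permutations_of_set {1..m}"
  shows "lehmer_code (join s t) = lehmer_code s @ lehmer_code t"
proof -
  have "lehmer_code (map ((+) (length s)) t) = lehmer_code t"
    by (rule lehmer_code_map) (simp add: strict_mono_def)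
  moreover have "lehmer_code (join s t) = lehmer_code s @ lehmer_code (map ((+) (length s)) t)"
    unfolding join_def
    using permutations_of_setD(1)[OF assms(1)] permutations_of_setD(1)[OF assms(2)] length_perm[OF assms(1)]
    by (intro lehmer_code_append) auto
  ultimately show ?thesis by simp
qed

lemma card_inversions_join:
  assumes "s \<in> permutations_of_set {1..h}" "t \<in> permutations_of_set {1..m}"
  shows "card (inversions (join s t)) = card (inversions s) + card (inversions t)"
  using card_inversions[OF permutations_of_setD(2)[OF assms(1)]] card_inversions[OF permutations_of_setD(2)[OF assms(2)]]
    card_inversions[OF permutations_of_setD(2)[OF join_perm[OF assms]]] lehmer_code_join[OF assms]
  by simp

context
  fixes s t :: "nat list" and h m :: nat
  assumes s: "s \<in> permutations_of_set {1..h}" and t: "t \<in> permutations_of_set {1..m}"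
begin

lemma join_nth_left: "i < h \<Longrightarrow> join s t ! i = s ! i"
  using length_perm[OF s] by (simp add: join_def nth_append)

lemma join_nth_right: "i < m \<Longrightarrow> join s t ! (h + i) = h + t ! i"
  using length_perm[OF s] length_perm[OF t] by (simp add: join_def nth_append)

lemma length_join: "length (join s t) = h + m"
  using length_perm[OF s] length_perm[OF t] by (simp add: join_def)

text \<open>Lets a comparison of values decide in which summand a position lies.\<close>

lemma join_nth_le_iff:
  assumes "i < h + m"
  shows "join s t ! i \<le> h \<longleftrightarrow> i < h"
proof (cases "i < h")
  case True
  then show ?thesis using nth_perm_bounds[OF s] by (simp add: join_nth_left)
next
  case False
  define i' where "i' = i - h"
  with False assms have "i = h + i'" "i' < m" by auto
  then show ?thesis using nth_perm_bounds[OF t, of i'] by (simp add: join_nth_right)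
qed

text \<open>Any entry of \<open>t\<close> completes a 132 in \<open>s\<close>, and any entry of
  \<open>s\<close> a 213 in \<open>t\<close>, so both must be nonempty. Conversely, if the 2 of a
  1324 lies in \<open>s\<close>, so does its 132; otherwise its 3, having a larger value, lies in
  \<open>t\<close>, and with it the whole 213.\<close>

lemma avoids_1324_join:
  assumes "h > 0" "m > 0"
  shows "avoids (join s t) [1, 3, 2, 4] \<longleftrightarrow> avoids s [1, 3, 2] \<and> avoids t [2, 1, 3]" (is "?L \<longleftrightarrow> ?R")
proof
  assume L: ?L
  have "avoids s [1, 3, 2]"
    unfolding avoids_132_nth length_perm[OF s]
  proof (intro notI, elim exE conjE)
    fix i j k assume *: "i < j" "j < k" "k < h" "s ! i < s ! k" "s ! k < s ! j"
    then have "s ! j < join s t ! h"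
      using join_nth_le_iff[of h] nth_perm_bounds[OF s, of j] assms by simp
    then have "join s t ! j < join s t ! h" using * by (simp add: join_nth_left)
    moreover have "join s t ! i < join s t ! k" "join s t ! k < join s t ! j"
      using * by (simp_all add: join_nth_left)
    moreover have "h < h + m" using assms by simp
    ultimately show False
      using L * unfolding avoids_1324_nth length_join by blast
  qed
  moreover have "avoids t [2, 1, 3]"
    unfolding avoids_213_nth length_perm[OF t]
  proof (intro notI, elim exE conjE)
    fix i j k assume *: "i < j" "j < k" "k < m" "t ! j < t ! i" "t ! i < t ! k"
    have "join s t ! 0 < join s t ! (h + j)"
      using join_nth_le_iff[of 0] join_nth_le_iff[of "h + j"] * assms by simp
    moreover have "join s t ! (h + j) < join s t ! (h + i)" "join s t ! (h + i) < join s t ! (h + k)"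
      using * by (simp_all add: join_nth_right)
    moreover have "0 < h + i" "h + i < h + j" "h + j < h + k" "h + k < h + m"
      using * assms by simp_all
    ultimately show False
      using L unfolding avoids_1324_nth length_join by blast
  qed
  ultimately show ?R ..
next
  assume R: ?R
  show ?L
    unfolding avoids_1324_nth length_join
  proof (intro notI, elim exE conjE)
    fix i j k l assume *: "i < j" "j < k" "k < l" "l < h + m" "join s t ! i < join s t ! k"
      "join s t ! k < join s t ! j" "join s t ! j < join s t ! l"
    show False
    proof (cases "k < h")
      case True
      then have "s ! i < s ! k" "s ! k < s ! j" using * by (simp_all add: join_nth_left)
      then show False using R * True unfolding avoids_132_nth length_perm[OF s] by blast
    next
      case False
      then have "h \<le> j"
        using * join_nth_le_iff[of k] join_nth_le_iff[of j] by simp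
      define j' k' l' where "j' = j - h" "k' = k - h" "l' = l - h"
      then have "j = h + j'" "k = h + k'" "l = h + l'" using * \<open>h \<le> j\<close> by simp_all
      then have "j' < k'" "k' < l'" "l' < m" "t ! k' < t ! j'" "t ! j' < t ! l'"
        using * by (simp_all add: join_nth_right)
      then show False
        using R unfolding avoids_213_nth length_perm[OF t] by blast
    qed
  qed
qed

text \<open>The last letter of 3421 is its smallest: if it lies in \<open>s\<close>, all positions
  do; if it lies in \<open>t\<close>, all values exceed \<open>h\<close>, so the whole occurrence
  lies in \<open>t\<close>.\<close>

lemma avoids_3421_join:
  "avoids (join s t) [3, 4, 2, 1] \<longleftrightarrow> avoids s [3, 4, 2, 1] \<and> avoids t [3, 4, 2, 1]" (is "?L \<longleftrightarrow> ?R")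
proof
  assume L: ?L
  have "avoids s [3, 4, 2, 1]"
    unfolding avoids_3421_nth length_perm[OF s]
  proof (intro notI, elim exE conjE)
    fix i j k l assume *: "i < j" "j < k" "k < l" "l < h" "s ! l < s ! k" "s ! k < s ! i" "s ! i < s ! j"
    then have "join s t ! l < join s t ! k" "join s t ! k < join s t ! i" "join s t ! i < join s t ! j"
      by (simp_all add: join_nth_left)
    moreover have "l < h + m" using * by simp
    ultimately show False
      using L * unfolding avoids_3421_nth length_join by blast
  qed
  moreover have "avoids t [3, 4, 2, 1]"
    unfolding avoids_3421_nth length_perm[OF t]
  proof (intro notI, elim exE conjE)
    fix i j k l assume *: "i < j" "j < k" "k < l" "l < m" "t ! l < t ! k" "t ! k < t ! i" "t ! i < t ! j"
    then have "join s t ! (h + l) < join s t ! (h + k)" "join s t ! (h + k) < join s t ! (h + i)"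
      "join s t ! (h + i) < join s t ! (h + j)"
      by (simp_all add: join_nth_right)
    moreover have "h + i < h + j" "h + j < h + k" "h + k < h + l" "h + l < h + m"
      using * by simp_all
    ultimately show False
      using L unfolding avoids_3421_nth length_join by blast
  qed
  ultimately show ?R ..
next
  assume R: ?R
  show ?L
    unfolding avoids_3421_nth length_join
  proof (intro notI, elim exE conjE)
    fix i j k l assume *: "i < j" "j < k" "k < l" "l < h + m" "join s t ! l < join s t ! k"
      "join s t ! k < join s t ! i" "join s t ! i < join s t ! j"
    show False
    proof (cases "l < h")
      case True
      then have "i < h" "j < h" "k < h" using * by auto
      then have "s ! l < s ! k" "s ! k < s ! i" "s ! i < s ! j" using True * by (simp_all add: join_nth_left)
      then show False using R * True unfolding avoids_3421_nth length_perm[OF s] by blast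
    next
      case False
      then have "h \<le> i"
        using * join_nth_le_iff[of l] join_nth_le_iff[of i] by simp
      define i' j' k' l' where "i' = i - h" "j' = j - h" "k' = k - h" "l' = l - h"
      then have "i = h + i'" "j = h + j'" "k = h + k'" "l = h + l'"
        using * \<open>h \<le> i\<close> by simp_all
      then have "i' < j'" "j' < k'" "k' < l'" "l' < m" "t ! l' < t ! k'" "t ! k' < t ! i'" "t ! i' < t ! j'"
        using * by (simp_all add: join_nth_right)
      then show False
        using R unfolding avoids_3421_nth length_perm[OF t] by blast
    qed
  qed
qed

end

section \<open>Recognising a direct sum\<close>

lemma initial_segment:
  fixes A B :: "nat set"
  assumes AB: "A \<union> B = {1..n}" and less: "\<And>a b. a \<in> A \<Longrightarrow> b \<in> B \<Longrightarrow> a < b"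
  shows "A = {1..card A}" "B = {card A + 1..n}"
proof -
  have fin: "finite A" using AB by (metis finite_Un finite_atLeastAtMost)
  have disj: "A \<inter> B = {}" using less by fastforce
  show A: "A = {1..card A}"
  proof (cases "A = {}")
    case False
    define M where "M = Max A"
    have M: "M \<in> A" "\<And>a. a \<in> A \<Longrightarrow> a \<le> M" using False fin by (auto simp: M_def)
    have "A = {1..M}"
    proof
      show "A \<subseteq> {1..M}" using AB M by auto
      show "{1..M} \<subseteq> A"
      proof
        fix x assume x: "x \<in> {1..M}"
        \<comment> \<open>Every \<open>x\<close> up to the maximum of \<open>A\<close> lies in
          \<open>A\<close>, since all of \<open>B\<close> is above that maximum.\<close>
        then have "x \<in> A \<union> B" unfolding AB using M AB by (metis UnI1 atLeastAtMost_iff order_trans)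
        then show "x \<in> A" using less[OF M(1), of x] x by auto
      qed
    qed
    then show ?thesis by simp
  qed simp
  have "B = {1..n} - A" using AB disj by auto
  then show "B = {card A + 1..n}" by (subst (asm) A) auto
qed

lemma join_decomp:
  assumes p: "p \<in> permutations_of_set {1..h + m}"
    and less: "\<And>i j. i < h \<Longrightarrow> h \<le> j \<Longrightarrow> j < h + m \<Longrightarrow> p ! i < p ! j"
  obtains s t where "s \<in> permutations_of_set {1..h}" "t \<in> permutations_of_set {1..m}" "p = join s t"
proof -
  let ?A = "set (take h p)" and ?B = "set (drop h p)"
  note D = permutations_of_setD[OF p]
  have AB: "?A \<union> ?B = {1..h + m}" using D(1) by (metis append_take_drop_id set_append)
  have "a < b" if ab: "a \<in> ?A" "b \<in> ?B" for a b
  proof -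
    obtain i where "i < h" "a = p ! i" using ab(1) by (auto simp: in_set_conv_nth)
    moreover obtain j where "h + j < h + m" "b = p ! (h + j)"
      using ab(2) length_perm[OF p] by (auto simp: in_set_conv_nth)
    ultimately show ?thesis using less by simp
  qed
  moreover have "card ?A = h" using D(2) length_perm[OF p] by (simp add: distinct_card)
  ultimately have A: "?A = {1..h}" and B: "?B = {h + 1..h + m}"
    using initial_segment[OF AB] by simp_all
  let ?t = "map (\<lambda>x. x - h) (drop h p)"
  have "(\<lambda>x. x - h) ` {h + 1..h + m} = {1..m}"
    by (auto simp: image_iff intro!: bexI[of _ "_ + h"])
  then have "set ?t = {1..m}" using B by simp
  moreover have "distinct ?t" using D(2) B by (auto simp: distinct_map inj_on_def)
  ultimately have "?t \<in> permutations_of_set {1..m}" by auto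
  moreover have "take h p \<in> permutations_of_set {1..h}" using A D(2) by auto
  moreover have "p = join (take h p) ?t"
  proof -
    have "map (\<lambda>x. h + (x - h)) (drop h p) = drop h p"
      by (rule map_idI) (use B in auto)
    then have "map ((+) h) ?t = drop h p" by (simp add: o_def)
    then show ?thesis using length_perm[OF p] by (simp add: join_def)
  qed
  ultimately show ?thesis using that by blast
qed

text \<open>The bounds on \<open>k\<close> make every avoider split at position \<open>h\<close>.
  The sum runs over the number \<open>i\<close> of inversions in the left summand.\<close>

lemma av_1324_3421_convolution:
  assumes "k < h" "k < m"
  shows "av (h + m) k {[1, 3, 2, 4], [3, 4, 2, 1]} =
    (\<Sum>i\<le>k. av h i {[1, 3, 2], [3, 4, 2, 1]} * av m (k - i) {[2, 1, 3], [3, 4, 2, 1]})"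
proof -
  let ?S = "\<lambda>n k B. {p \<in> permutations_of_set {1..n}. card (inversions p) = k \<and> (\<forall>q\<in>B. avoids p q)}"
  let ?P = "SIGMA i:{..k}. ?S h i {[1, 3, 2], [3, 4, 2, 1]} \<times> ?S m (k - i) {[2, 1, 3], [3, 4, 2, 1]}"
  let ?f = "\<lambda>(i, s, t). join s t"
  have pos: "h > 0" "m > 0" using assms by auto
  have inj: "inj_on ?f ?P"
  proof (rule inj_onI)
    fix x y assume x: "x \<in> ?P" and y: "y \<in> ?P" and eq: "?f x = ?f y"
    obtain i s t i' s' t' where [simp]: "x = (i, s, t)" "y = (i', s', t')" by (metis prod_cases3)
    have "length s = h" "length s' = h"
      using x y length_perm by auto
    then have "s = s'" "t = t'" using eq by (auto simp: join_def inj_map_eq_map)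
    then show "x = y" using x y by auto
  qed
  have image: "?f ` ?P = ?S (h + m) k {[1, 3, 2, 4], [3, 4, 2, 1]}"
  proof
    show "?f ` ?P \<subseteq> ?S (h + m) k {[1, 3, 2, 4], [3, 4, 2, 1]}"
      using pos by (auto simp: join_perm card_inversions_join avoids_1324_join avoids_3421_join)
    show "?S (h + m) k {[1, 3, 2, 4], [3, 4, 2, 1]} \<subseteq> ?f ` ?P"
    proof
      fix p assume p: "p \<in> ?S (h + m) k {[1, 3, 2, 4], [3, 4, 2, 1]}"
      then obtain s t where st: "s \<in> permutations_of_set {1..h}" "t \<in> permutations_of_set {1..m}"
        and j: "p = join s t"
        using join_decomp[of p h m] avoider_1324_split[of p "h + m" h] assms by auto
      have "(card (inversions s), s, t) \<in> ?P"
        using p st pos by (auto simp: j card_inversions_join avoids_1324_join avoids_3421_join)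
      then show "p \<in> ?f ` ?P" by (rule rev_image_eqI) (simp add: j)
    qed
  qed
  have "av (h + m) k {[1, 3, 2, 4], [3, 4, 2, 1]} = card ?P"
    unfolding av_def image[symmetric] by (rule card_image[OF inj])
  also have "\<dots> = (\<Sum>i\<le>k. av h i {[1, 3, 2], [3, 4, 2, 1]} * av m (k - i) {[2, 1, 3], [3, 4, 2, 1]})"
    by (subst card_SigmaI) (auto simp: av_def card_cartesian_product)
  finally show ?thesis .
qed

section \<open>Existence and value of the limit sequence\<close>

lemma limit_sequence_eqI:
  assumes "is_limit_sequence B c"
  shows "limit_sequence B = c"
  unfolding limit_sequence_def
proof (rule the_equality)
  fix c' assume c': "is_limit_sequence B c'"
  show "c' = c"
  proof
    fix k
    obtain m where m: "\<forall>n\<ge>m. av n k B = c k"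
      using assms unfolding is_limit_sequence_def by blast
    obtain m' where m': "\<forall>n\<ge>m'. av n k B = c' k"
      using c' unfolding is_limit_sequence_def by blast
    have "c' k = av (max m m') k B" using m' by simp
    also have "\<dots> = c k" using m by simp
    finally show "c' k = c k" .
  qed
qed fact

lemma is_limit_sequence_1324_3421:
  "is_limit_sequence {[1, 3, 2, 4], [3, 4, 2, 1]}
     (\<lambda>k. \<Sum>i\<le>k. card (good_partitions i i) * card (good_partitions (k - i) (k - i)))"
  unfolding is_limit_sequence_def
proof (intro allI exI impI)
  fix k n :: nat assume n: "2 * k + 2 \<le> n"
  \<comment> \<open>The left block has the fixed length \<open>k + 1\<close>, the right one the
    rest; both exceed \<open>k\<close>, and then the counts of avoiders depend only on inversion
    numbers.\<close>
  define m where "m = n - (k + 1)"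
  have m: "n = (k + 1) + m" "k < m" using n by (auto simp: m_def)
  show "av n k {[1, 3, 2, 4], [3, 4, 2, 1]} =
      (\<Sum>i\<le>k. card (good_partitions i i) * card (good_partitions (k - i) (k - i)))"
    unfolding m(1) using m(2)
    by (subst av_1324_3421_convolution)
      (auto simp: av_213_3421 card_avoiders_132_3421 intro!: sum.cong)
qed

theorem proposition5p15:
  shows "(\<exists>c. is_limit_sequence {[1, 3, 2, 4], [3, 4, 2, 1]} c) \<and>
    limit_gf {[1, 3, 2, 4], [3, 4, 2, 1]} =
      (1 + (\<Sum>k. fps_X ^ (k + 1) / (1 - fps_X ^ (k + 1)) *
                  (\<Prod>i. 1 + fps_X ^ (i + (k + 1) + 1)))) ^ 2"
proof
  show "\<exists>c. is_limit_sequence {[1, 3, 2, 4], [3, 4, 2, 1]} c"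
    using is_limit_sequence_1324_3421 by blast
  show "limit_gf {[1, 3, 2, 4], [3, 4, 2, 1]} =
      (1 + (\<Sum>k. fps_X ^ (k + 1) / (1 - fps_X ^ (k + 1)) *
                  (\<Prod>i. 1 + fps_X ^ (i + (k + 1) + 1)))) ^ 2"
    unfolding suminf_good_partitions limit_gf_def limit_sequence_eqI[OF is_limit_sequence_1324_3421]
    \<comment> \<open>The convolution is the Cauchy product of the partition series with
      itself.\<close>
    by (rule fps_ext) (simp add: power2_eq_square fps_mult_nth atLeast0AtMost)
qed

end
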